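(* Let $\mathbb{K}$ be an algebraically closed field, $q\in\mathbb{K}$ a primitive $l$-th root of unity with $l\ge3$, and $\underline{\mu}=(\mu_1,\mu_2)\in(\mathbb{K}^* )^2$. Let $l_1$ be the multiplicative order of $q^2$. Then the module $M_3(\underline{\mu})$ is a simple $\mathcal{A}$-module of dimension $l_1l$ over $\mathbb{K}$.
   Context: The quantum spatial ageing algebra $\mathcal{A}$ is the $\mathbb{K}$-algebra generated by $E,K,K^{-1},X,Y$ ($K^{-1}$ the inverse of $K$) with relations $$EK=q^{-2}KE,\quad XK=q^{-1}KX,\quad YK=qKY,\quad EX=qXE,\quad EY=X+q^{-1}YE,\quad XY=qYX.$$ Modules are right modules. We have $l_1=l$ if $l$ is odd and $l_1=l/2$ if $l$ is even. $M_3(\underline{\mu})$ has $\mathbb{K}$-basis $\{e(a_1,a_2): 0\le a_1\le l_1-1,\ 0\le a_2\le l-1\}$; in the first argument addition is modulo $l_1$, in the second modulo $l$. The action is: $e(a_1,a_2)X=\mu_1q^{-a_1+a_2}e(a_1,a_2)$, $e(a_1,a_2)K^{\pm1}=\mu_2^{\pm1}e(a_1,a_2\pm1)$, $e(a_1,a_2)E=-q^{a_1+2a_2}\mu_1\frac{q^{-2a_1}-1}{q^{-2}-1}e(a_1-1,a_2)$ for $a_1\neq0$, $e(0,a_2)E=0$, $e(a_1,a_2)Y=q^{-a_2}e(a_1+1,a_2)$ for $a_1\ne l_1-1$, $e(l_1-1,a_2)Y=0$. *)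

theory Defs
  imports
    "HOL-Library.Poly_Mapping"
    "HOL-Computational_Algebra.Polynomial"
    "HOL-Algebra.Algebraic_Closure_Type"
    "HOL-Algebra.QuotRing"
    "HOL-Algebra.Module"
begin

section \<open>Roots of unity\<close>

definition primitive_root_of_unity :: "nat \<Rightarrow> 'k::field \<Rightarrow> bool" where
  "primitive_root_of_unity l q \<longleftrightarrow> 0 < l \<and> q ^ l = 1 \<and> (\<forall>k. 0 < k \<and> k < l \<longrightarrow> q ^ k \<noteq> 1)"

definition mult_order :: "'k::field \<Rightarrow> nat" where
  "mult_order x = (LEAST n. 0 < n \<and> x ^ n = 1)"


section \<open>Free algebras\<close>

text \<open>
  With lists as the free monoid, written additively, the convolution product of
  \<^theory>\<open>HOL-Library.Poly_Mapping\<close> turns \<^typ>\<open>'g list \<Rightarrow>\<^sub>0 'k\<close> into the free associative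
  algebra on \<^typ>\<open>'g\<close>.
\<close>

instantiation list :: (type) monoid_add
begin
definition zero_list_def: "0 = ([] :: 'a list)"
definition plus_list_def: "(xs :: 'a list) + ys = xs @ ys"
instance by standard (simp_all add: zero_list_def plus_list_def)
end

definition free_gen :: "'g \<Rightarrow> ('g list \<Rightarrow>\<^sub>0 'k::field)" where
  "free_gen g = Poly_Mapping.single [g] 1"

definition free_const :: "'k \<Rightarrow> ('g list \<Rightarrow>\<^sub>0 'k::field)" where
  "free_const c = Poly_Mapping.single [] c"


section \<open>The quantum spatial ageing algebra\<close>

datatype ageing_gen = GE | GK | GKinv | GX | GY

definition ageing_relations :: "'k::field \<Rightarrow> (ageing_gen list \<Rightarrow>\<^sub>0 'k) set" where
  "ageing_relations q =
    (let e = free_gen GE; k = free_gen GK; k' = free_gen GKinv; x = free_gen GX; y = free_gen GY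
     in {k * k' - 1,
         k' * k - 1,
         e * k - free_const (q powi (-2)) * (k * e),
         x * k - free_const (q powi (-1)) * (k * x),
         y * k - free_const q * (k * y),
         e * x - free_const q * (x * e),
         e * y - (x + free_const (q powi (-1)) * (y * e)),
         x * y - free_const q * (y * x)})"

definition free_ring :: "('g list \<Rightarrow>\<^sub>0 'k::field) ring" where
  "free_ring = ring_of_type_algebra"

definition ageing_ideal :: "'k::field \<Rightarrow> (ageing_gen list \<Rightarrow>\<^sub>0 'k) set" where
  "ageing_ideal q = Idl\<^bsub>free_ring\<^esub> (ageing_relations q)"

definition ageing_algebra :: "'k::field \<Rightarrow> (ageing_gen list \<Rightarrow>\<^sub>0 'k) set ring" where
  "ageing_algebra q = free_ring Quot (ageing_ideal q)"


section \<open>Right modules over a noncommutative ring\<close>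

text \<open>
  The library's \<^locale>\<open>module\<close> requires a commutative ring.  Its record is reused here, but
  \<open>a \<odot>\<^bsub>M\<^esub> x\<close> stands for the right action \<open>x a\<close>, whence the order of the factors in \<open>smult_assoc\<close>.
  The predicate \<^const>\<open>submodule\<close> does not depend on the side.
\<close>

locale right_module = R?: ring R + M?: abelian_group M
  for R :: "('a, 'b) ring_scheme" (structure) and M :: "('a, 'c, 'd) module_scheme" (structure) +
  assumes smult_closed:
      "\<lbrakk>a \<in> carrier R; x \<in> carrier M\<rbrakk> \<Longrightarrow> a \<odot>\<^bsub>M\<^esub> x \<in> carrier M"
    and smult_l_distr:
      "\<lbrakk>a \<in> carrier R; b \<in> carrier R; x \<in> carrier M\<rbrakk> \<Longrightarrow>
        (a \<oplus>\<^bsub>R\<^esub> b) \<odot>\<^bsub>M\<^esub> x = a \<odot>\<^bsub>M\<^esub> x \<oplus>\<^bsub>M\<^esub> b \<odot>\<^bsub>M\<^esub> x"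
    and smult_r_distr:
      "\<lbrakk>a \<in> carrier R; x \<in> carrier M; y \<in> carrier M\<rbrakk> \<Longrightarrow>
        a \<odot>\<^bsub>M\<^esub> (x \<oplus>\<^bsub>M\<^esub> y) = a \<odot>\<^bsub>M\<^esub> x \<oplus>\<^bsub>M\<^esub> a \<odot>\<^bsub>M\<^esub> y"
    and smult_assoc:
      "\<lbrakk>a \<in> carrier R; b \<in> carrier R; x \<in> carrier M\<rbrakk> \<Longrightarrow>
        (a \<otimes>\<^bsub>R\<^esub> b) \<odot>\<^bsub>M\<^esub> x = b \<odot>\<^bsub>M\<^esub> (a \<odot>\<^bsub>M\<^esub> x)"
    and smult_one:
      "x \<in> carrier M \<Longrightarrow> \<one>\<^bsub>R\<^esub> \<odot>\<^bsub>M\<^esub> x = x"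

definition simple_right_module ::
    "('a, 'b) ring_scheme \<Rightarrow> ('a, 'c, 'd) module_scheme \<Rightarrow> bool" where
  "simple_right_module R M \<longleftrightarrow>
     right_module R M \<and> carrier M \<noteq> {\<zero>\<^bsub>M\<^esub>} \<and>
     (\<forall>N. submodule N R M \<longrightarrow> N = {\<zero>\<^bsub>M\<^esub>} \<or> N = carrier M)"


section \<open>The module \<open>M\<^sub>3(\<mu>)\<close>\<close>

definition scale :: "'k \<Rightarrow> ('i \<Rightarrow>\<^sub>0 'k) \<Rightarrow> ('i \<Rightarrow>\<^sub>0 'k::field)" where
  "scale c v = Poly_Mapping.map ((*) c) v"

lemma lookup_scale [simp]: "Poly_Mapping.lookup (scale c v) i = c * Poly_Mapping.lookup v i"
  by (simp add: scale_def Poly_Mapping.map.rep_eq when_def)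

lemma vector_space_scale: "vector_space scale"
  by standard (rule poly_mapping_eqI; simp add: lookup_add algebra_simps)+

definition linear_extension :: "('i \<Rightarrow> ('j \<Rightarrow>\<^sub>0 'k)) \<Rightarrow> ('i \<Rightarrow>\<^sub>0 'k) \<Rightarrow> ('j \<Rightarrow>\<^sub>0 'k::field)" where
  "linear_extension f v = (\<Sum>i\<in>Poly_Mapping.keys v. scale (Poly_Mapping.lookup v i) (f i))"

text \<open>
  The basis vector \<open>e(a\<^sub>1, a\<^sub>2)\<close> is \<open>Poly_Mapping.single (a\<^sub>1, a\<^sub>2) 1\<close>.
\<close>

fun M3_basis_act ::
    "nat \<Rightarrow> nat \<Rightarrow> 'k \<Rightarrow> 'k \<Rightarrow> 'k \<Rightarrow> ageing_gen \<Rightarrow> nat \<times> nat \<Rightarrow> (nat \<times> nat \<Rightarrow>\<^sub>0 'k::field)" where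
  "M3_basis_act l1 l q \<mu>1 \<mu>2 GX (a1, a2) =
     Poly_Mapping.single (a1, a2) (\<mu>1 * q powi (- int a1 + int a2))"
| "M3_basis_act l1 l q \<mu>1 \<mu>2 GK (a1, a2) =
     Poly_Mapping.single (a1, (a2 + 1) mod l) \<mu>2"
| "M3_basis_act l1 l q \<mu>1 \<mu>2 GKinv (a1, a2) =
     Poly_Mapping.single (a1, (a2 + (l - 1)) mod l) (inverse \<mu>2)"
| "M3_basis_act l1 l q \<mu>1 \<mu>2 GE (a1, a2) =
     (if a1 = 0 then 0
      else Poly_Mapping.single (a1 - 1, a2)
        (- (q powi (int a1 + 2 * int a2)) * \<mu>1 *
          ((q powi (- 2 * int a1) - 1) / (q powi (-2) - 1))))"
| "M3_basis_act l1 l q \<mu>1 \<mu>2 GY (a1, a2) =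
     (if a1 = l1 - 1 then 0
      else Poly_Mapping.single (a1 + 1, a2) (q powi (- int a2)))"

text \<open>Since the action is on the right, the first letter of a word acts first.\<close>

definition M3_word_act ::
    "nat \<Rightarrow> nat \<Rightarrow> 'k \<Rightarrow> 'k \<Rightarrow> 'k \<Rightarrow> ageing_gen list \<Rightarrow> (nat \<times> nat \<Rightarrow>\<^sub>0 'k) \<Rightarrow> (nat \<times> nat \<Rightarrow>\<^sub>0 'k::field)" where
  "M3_word_act l1 l q \<mu>1 \<mu>2 w v = fold (\<lambda>g. linear_extension (M3_basis_act l1 l q \<mu>1 \<mu>2 g)) w v"

definition M3_free_act ::
    "nat \<Rightarrow> nat \<Rightarrow> 'k \<Rightarrow> 'k \<Rightarrow> 'k \<Rightarrow> (ageing_gen list \<Rightarrow>\<^sub>0 'k) \<Rightarrow> (nat \<times> nat \<Rightarrow>\<^sub>0 'k) \<Rightarrow> (nat \<times> nat \<Rightarrow>\<^sub>0 'k::field)" where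
  "M3_free_act l1 l q \<mu>1 \<mu>2 p v = linear_extension (\<lambda>w. M3_word_act l1 l q \<mu>1 \<mu>2 w v) p"

text \<open>
  A residue class acts as the common action of its representatives; see \<open>M3_smult_coset\<close> below for
  well-definedness.  The module axioms ignore the fields \<open>mult\<close> and \<open>one\<close> of the record.
\<close>

definition M3 ::
    "nat \<Rightarrow> nat \<Rightarrow> 'k \<Rightarrow> 'k \<Rightarrow> 'k \<Rightarrow> ((ageing_gen list \<Rightarrow>\<^sub>0 'k) set, nat \<times> nat \<Rightarrow>\<^sub>0 'k::field) module" where
  "M3 l1 l q \<mu>1 \<mu>2 =
    \<lparr>carrier = {v. Poly_Mapping.keys v \<subseteq> {..<l1} \<times> {..<l}},
     monoid.mult = undefined, one = undefined,
     ring.zero = 0, add = (+),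
     module.smult = (\<lambda>C v. THE u. \<forall>p\<in>C. M3_free_act l1 l q \<mu>1 \<mu>2 p v = u)\<rparr>"


section \<open>Well-definedness of the action\<close>

lemma free_ring_ring: "ring (free_ring :: ('g list \<Rightarrow>\<^sub>0 'k::field) ring)"
proof -
  have "\<exists>y. x + y = 0" for x :: "'g list \<Rightarrow>\<^sub>0 'k"
    using add.right_inverse by blast
  thus ?thesis
    unfolding free_ring_def ring_of_type_algebra_def using add.right_inverse
    by unfold_locales (auto simp:algebra_simps Units_def)
qed

lemma ageing_ideal_ideal: "ideal (ageing_ideal q) free_ring"
  unfolding ageing_ideal_def
  by (rule ring.genideal_ideal[OF free_ring_ring]) (simp add: free_ring_def ring_of_type_algebra_def)

lemma ageing_algebra_ring: "ring (ageing_algebra q)"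
  unfolding ageing_algebra_def by (rule ideal.quotient_is_ring[OF ageing_ideal_ideal])

lemma sum_singles: "(\<Sum>i\<in>Poly_Mapping.keys p. Poly_Mapping.single i (Poly_Mapping.lookup p i)) = p"
  by (rule poly_mapping_eqI) (simp add: lookup_sum lookup_single when_def in_keys_iff)

lemma poly_mapping_additive_induct:
  assumes "\<And>i c. P (Poly_Mapping.single i c)" "\<And>a b. P a \<Longrightarrow> P b \<Longrightarrow> P (a + b)"
  shows "P (p :: 'i \<Rightarrow>\<^sub>0 'k::field)"
proof -
  have "P (\<Sum>i\<in>A. Poly_Mapping.single i (Poly_Mapping.lookup p i))" if "finite A" for A
    using that
  proof induct
    case empty
    show ?case using assms(1)[of undefined 0] by simp
  next
    case (insert x F)
    then show ?case using assms by simp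
  qed
  from this[of "Poly_Mapping.keys p"] show ?thesis
    by (simp add: sum_singles)
qed

interpretation scale: vector_space scale by (rule vector_space_scale)

lemma scale_single: "scale c (Poly_Mapping.single i d) = Poly_Mapping.single i (c * d)"
  by (rule poly_mapping_eqI) (simp add: lookup_single when_def)

lemma linear_extension_superset:
  assumes "finite A" "Poly_Mapping.keys v \<subseteq> A"
  shows "linear_extension f v = (\<Sum>i\<in>A. scale (Poly_Mapping.lookup v i) (f i))"
  unfolding linear_extension_def
  by (rule sum.mono_neutral_left) (use assms in \<open>auto simp: in_keys_iff\<close>)

lemma linear_extension_add: "linear_extension f (u + v) = linear_extension f u + linear_extension f v"
proof -
  let ?A = "Poly_Mapping.keys u \<union> Poly_Mapping.keys v"
  have "Poly_Mapping.keys (u + v) \<subseteq> ?A" by (rule keys_add)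
  then show ?thesis
    by (simp add: linear_extension_superset[of ?A] lookup_add scale.scale_left_distrib sum.distrib)
qed

lemma linear_extension_scale: "linear_extension f (scale c v) = scale c (linear_extension f v)"
proof -
  have "Poly_Mapping.keys (scale c v) \<subseteq> Poly_Mapping.keys v" by (auto simp: in_keys_iff)
  then show ?thesis
    by (simp add: linear_extension_superset[of "Poly_Mapping.keys v"] scale.scale_sum_right)
qed

lemma linear_extension_single: "linear_extension f (Poly_Mapping.single i c) = scale c (f i)"
  by (simp add: linear_extension_superset[of "{i}"])

lemma linear_extension_zero: "linear_extension f 0 = 0"
  by (simp add: linear_extension_def)

lemma M3_word_act_Cons: "M3_word_act l1 l q \<mu>1 \<mu>2 (g # w) v =
   M3_word_act l1 l q \<mu>1 \<mu>2 w (linear_extension (M3_basis_act l1 l q \<mu>1 \<mu>2 g) v)"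
  and M3_word_act_Nil: "M3_word_act l1 l q \<mu>1 \<mu>2 [] v = v"
  and M3_word_act_append: "M3_word_act l1 l q \<mu>1 \<mu>2 (w @ w') v = M3_word_act l1 l q \<mu>1 \<mu>2 w' (M3_word_act l1 l q \<mu>1 \<mu>2 w v)"
  by (simp_all add: M3_word_act_def)

lemma M3_word_act_add: "M3_word_act l1 l q \<mu>1 \<mu>2 w (u + v) =
   M3_word_act l1 l q \<mu>1 \<mu>2 w u + M3_word_act l1 l q \<mu>1 \<mu>2 w v"
  by (induct w arbitrary: u v) (simp_all add: M3_word_act_Cons M3_word_act_Nil linear_extension_add)

lemma M3_word_act_scale: "M3_word_act l1 l q \<mu>1 \<mu>2 w (scale c v) = scale c (M3_word_act l1 l q \<mu>1 \<mu>2 w v)"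
  by (induct w arbitrary: v) (simp_all add: M3_word_act_Cons M3_word_act_Nil linear_extension_scale)

lemma M3_free_act_add: "M3_free_act l1 l q \<mu>1 \<mu>2 (p + p') v = M3_free_act l1 l q \<mu>1 \<mu>2 p v + M3_free_act l1 l q \<mu>1 \<mu>2 p' v"
  by (simp add: M3_free_act_def linear_extension_add)

lemma M3_free_act_single: "M3_free_act l1 l q \<mu>1 \<mu>2 (Poly_Mapping.single w c) v = scale c (M3_word_act l1 l q \<mu>1 \<mu>2 w v)"
  by (simp add: M3_free_act_def linear_extension_single)

lemma M3_free_act_add_right: "M3_free_act l1 l q \<mu>1 \<mu>2 p (u + v) = M3_free_act l1 l q \<mu>1 \<mu>2 p u + M3_free_act l1 l q \<mu>1 \<mu>2 p v"
  by (simp add: M3_free_act_def linear_extension_def M3_word_act_add scale.scale_right_distrib sum.distrib)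

lemma M3_free_act_scale_right: "M3_free_act l1 l q \<mu>1 \<mu>2 p (scale c v) = scale c (M3_free_act l1 l q \<mu>1 \<mu>2 p v)"
  by (simp add: M3_free_act_def linear_extension_def M3_word_act_scale scale.scale_sum_right mult.commute)

lemma M3_free_act_zero_right: "M3_free_act l1 l q \<mu>1 \<mu>2 p 0 = 0"
  using M3_free_act_scale_right[of l1 l q \<mu>1 \<mu>2 p 0 0] by simp

lemma M3_free_act_zero: "M3_free_act l1 l q \<mu>1 \<mu>2 0 v = 0"
  by (simp add: M3_free_act_def linear_extension_zero)

lemma M3_free_act_uminus: "M3_free_act l1 l q \<mu>1 \<mu>2 (-p) v = - M3_free_act l1 l q \<mu>1 \<mu>2 p v"
  using M3_free_act_add[of l1 l q \<mu>1 \<mu>2 "-p" p v] by (simp add: M3_free_act_zero eq_neg_iff_add_eq_0)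

lemma M3_free_act_diff: "M3_free_act l1 l q \<mu>1 \<mu>2 (p - p') v = M3_free_act l1 l q \<mu>1 \<mu>2 p v - M3_free_act l1 l q \<mu>1 \<mu>2 p' v"
  using M3_free_act_add[of l1 l q \<mu>1 \<mu>2 p "-p'" v] by (simp add: M3_free_act_uminus)

lemma M3_free_act_mult: "M3_free_act l1 l q \<mu>1 \<mu>2 (p * p') v = M3_free_act l1 l q \<mu>1 \<mu>2 p' (M3_free_act l1 l q \<mu>1 \<mu>2 p v)"
proof (induct p rule: poly_mapping_additive_induct)
  case (1 i c)
  show ?case
    by (induct p' rule: poly_mapping_additive_induct)
      (simp_all add: mult_single M3_free_act_single plus_list_def M3_word_act_append M3_word_act_scale
         distrib_left M3_free_act_add mult.commute)
next
  case (2 a b)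
  then show ?case by (simp add: distrib_right M3_free_act_add M3_free_act_add_right)
qed

lemma M3_free_act_one: "M3_free_act l1 l q \<mu>1 \<mu>2 1 v = v"
  by (simp add: single_one[symmetric] zero_list_def M3_free_act_single M3_word_act_Nil del: single_one)

lemma M3_free_act_const: "M3_free_act l1 l q \<mu>1 \<mu>2 (free_const c) v = scale c v"
  by (simp add: free_const_def M3_free_act_single M3_word_act_Nil)

lemma M3_free_act_gen: "M3_free_act l1 l q \<mu>1 \<mu>2 (free_gen g) v = linear_extension (M3_basis_act l1 l q \<mu>1 \<mu>2 g) v"
  by (simp add: free_gen_def M3_free_act_single M3_word_act_Cons M3_word_act_Nil)

lemma power_mod_root: assumes "q ^ l = (1::'k::field)" shows "q ^ (n mod l) = q ^ n"
proof -
  have "q ^ n = q ^ (l * (n div l) + n mod l)" by simp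
  also have "\<dots> = q ^ (n mod l)" unfolding power_add power_mult assms by simp
  finally show ?thesis by simp
qed

context
  fixes l l1 :: nat and q \<mu>1 \<mu>2 :: "'k::field"
  assumes l: "l \<ge> 3" and q: "primitive_root_of_unity l q" and \<mu>1: "\<mu>1 \<noteq> 0" and \<mu>2: "\<mu>2 \<noteq> 0"
    and l1: "l1 = mult_order (q^2)"
begin

lemma root_power_l: "q ^ l = 1" and root_power_less: "0 < k \<Longrightarrow> k < l \<Longrightarrow> q ^ k \<noteq> 1" and root_nonzero: "q \<noteq> 0"
proof -
  show *: "q ^ l = 1" and "0 < k \<Longrightarrow> k < l \<Longrightarrow> q ^ k \<noteq> 1"
    using q by (auto simp: primitive_root_of_unity_def)
  show "q \<noteq> 0" using * l by (auto simp: power_0_left)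
qed

lemma mult_order_pos: "0 < l1" and mult_order_power: "(q^2) ^ l1 = 1" and mult_order_minimal: "0 < k \<Longrightarrow> k < l1 \<Longrightarrow> (q^2) ^ k \<noteq> 1"
proof -
  have "0 < l \<and> (q^2)^l = 1" using l root_power_l by (simp add: power_mult[symmetric] mult.commute[of 2]) (simp add: power_mult)
  then have "0 < l1 \<and> (q^2)^l1 = 1" unfolding l1 mult_order_def by (rule LeastI)
  then show "0 < l1" and "(q^2) ^ l1 = 1" by auto
  show "0 < k \<Longrightarrow> k < l1 \<Longrightarrow> (q^2) ^ k \<noteq> 1"
    unfolding l1 mult_order_def using not_less_Least by blast
qed

lemma root_square_neq_1: "q^2 \<noteq> 1" using root_power_less[of 2] l by simp

lemma mult_order_gt_1: "l1 > 1" using mult_order_power mult_order_pos root_square_neq_1 by (cases "l1 = 1") auto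

lemma powi_int_nat: "q powi (int n) = q ^ n" "q powi (- int n) = inverse q ^ n"
  by (simp_all add: power_int_def root_nonzero power_inverse)

lemma M3_act_basis:
  assumes "a1 < l1" "a2 < l" "r \<in> ageing_relations q"
  shows "M3_free_act l1 l q \<mu>1 \<mu>2 r (Poly_Mapping.single (a1, a2) 1) = 0"
proof -
  have lmod: "Suc ((a2 + (l - Suc 0)) mod l) mod l = a2" "(Suc a2 mod l + (l - Suc 0)) mod l = a2"
  proof -
    have "Suc ((a2 + (l - Suc 0)) mod l) mod l = (a2 + l) mod l"
      using l by (simp add: mod_Suc_eq flip: add_Suc_right)
    then show "Suc ((a2 + (l - Suc 0)) mod l) mod l = a2" using assms by simp
    show "(Suc a2 mod l + (l - Suc 0)) mod l = a2"
      using assms l by (cases "Suc a2 = l") simp_all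
  qed
  define Q where "Q = inverse q"
  have Q: "Q * q = 1" "q * Q = 1" using root_nonzero by (auto simp: Q_def)
  have Qq: "q * (Q * x) = x" "Q * (q * x) = x" for x by (simp_all add: Q mult.assoc[symmetric])
  have cancel: "Q * (x * (q * z)) = x * z" "q * (x * (Q * z)) = x * z"
    "Q * (x * (y * (q * z))) = x * (y * z)" "q * (x * (y * (Q * z))) = x * (y * z)"
    "Q * (x * q) = x" "q * (x * Q) = x" for x y z
    using root_nonzero by (simp_all add: Q_def)
  have p1: "q powi (- int a1 + int a2) = Q ^ a1 * q ^ a2" for a1 a2
    by (subst power_int_add) (simp_all add: root_nonzero powi_int_nat Q_def)
  have p2: "q powi (int a1 + 2 * int a2) = q ^ a1 * q ^ a2 * q ^ a2" for a1 a2
  proof -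
    have "int a1 + 2 * int a2 = int (a1 + a2 + a2)" by simp
    then show ?thesis by (simp only: powi_int_nat power_add)
  qed
  have p3: "q powi (- 2 * int a1) = Q ^ a1 * Q ^ a1" for a1
  proof -
    have "- 2 * int a1 = - int (a1 + a1)" by simp
    then show ?thesis by (simp only: powi_int_nat power_add Q_def)
  qed
  have p4: "q powi (- int a) = Q ^ a" for a by (simp add: powi_int_nat Q_def)
  have p5: "q powi (-2) = Q * Q" "q powi (-1) = Q"
    using p4[of 2] p4[of 1] by (simp_all add: power2_eq_square)
  have qS: "q ^ (Suc a2 mod l) = q * q ^ a2" using power_mod_root[OF root_power_l, of "Suc a2"] by simp
  have Ql: "Q ^ l = 1" using root_power_l by (simp add: Q_def power_inverse)
  have QS: "Q ^ (Suc a2 mod l) = Q * Q ^ a2" using power_mod_root[OF Ql, of "Suc a2"] by simp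
  have QQ: "Q * Q - 1 \<noteq> 0"
  proof
    assume "Q * Q - 1 = 0"
    then have "Q * Q = 1" by simp
    then have "q * (q * (Q * Q)) = q * q" by simp
    then show False using root_square_neq_1 by (simp add: Qq Q power2_eq_square)
  qed
  have QqP: "Q ^ n * q ^ n = 1" "q ^ n * Q ^ n = 1" for n by (simp_all add: power_mult_distrib[symmetric] Q)
  have QqP': "Q ^ n * (q ^ n * x) = x" "q ^ n * (Q ^ n * x) = x" for n x by (simp_all add: QqP mult.assoc[symmetric])
  have cancel': "Q ^ n * (x * (q ^ n * z)) = x * z" for n x z
    by (simp add: mult.left_commute[of "Q ^ n" x] QqP')
  have top: "Q ^ a1 * Q ^ a1 = q * q" if "a1 = l1 - 1"
  proof -
    have "(Q^2) ^ l1 = 1" using mult_order_power by (simp add: Q_def power_inverse)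
    moreover have "l1 = Suc a1" using that mult_order_pos by simp
    ultimately have "Q * (Q * (Q ^ a1 * Q ^ a1)) = 1"
      by (simp add: power_mult_distrib power2_eq_square mult.assoc)
    then have "q * (q * (Q * (Q * (Q ^ a1 * Q ^ a1)))) = q * q" by simp
    then show ?thesis by (simp add: Qq)
  qed
  have basis_act:
    "M3_basis_act l1 l q \<mu>1 \<mu>2 GX (a1, a2) = Poly_Mapping.single (a1, a2) (\<mu>1 * (Q ^ a1 * q ^ a2))"
    "M3_basis_act l1 l q \<mu>1 \<mu>2 GK (a1, a2) = Poly_Mapping.single (a1, Suc a2 mod l) \<mu>2"
    "M3_basis_act l1 l q \<mu>1 \<mu>2 GKinv (a1, a2) =
       Poly_Mapping.single (a1, (a2 + (l - Suc 0)) mod l) (inverse \<mu>2)"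
    "M3_basis_act l1 l q \<mu>1 \<mu>2 GE (a1, a2) =
       (if a1 = 0 then 0 else Poly_Mapping.single (a1 - 1, a2)
          (- (q ^ a1 * q ^ a2 * q ^ a2) * \<mu>1 * ((Q ^ a1 * Q ^ a1 - 1) / (Q * Q - 1))))"
    "M3_basis_act l1 l q \<mu>1 \<mu>2 GY (a1, a2) =
       (if a1 = l1 - 1 then 0 else Poly_Mapping.single (a1 + 1, a2) (Q ^ a2))" for a1 a2
    by (simp_all only: M3_basis_act.simps p1 p2 p3 p4 p5) simp_all
  note [simp del] = M3_basis_act.simps
  note S = basis_act M3_free_act_diff M3_free_act_add M3_free_act_mult M3_free_act_gen M3_free_act_const M3_free_act_one
     linear_extension_single scale_single linear_extension_zero
  consider "r = free_gen GK * free_gen GKinv - 1"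
    | "r = free_gen GKinv * free_gen GK - 1"
    | "r = free_gen GE * free_gen GK - free_const (q powi (-2)) * (free_gen GK * free_gen GE)"
    | "r = free_gen GX * free_gen GK - free_const (q powi (-1)) * (free_gen GK * free_gen GX)"
    | "r = free_gen GY * free_gen GK - free_const q * (free_gen GK * free_gen GY)"
    | "r = free_gen GE * free_gen GX - free_const q * (free_gen GX * free_gen GE)"
    | "r = free_gen GE * free_gen GY - (free_gen GX + free_const (q powi (-1)) * (free_gen GY * free_gen GE))"
    | "r = free_gen GX * free_gen GY - free_const q * (free_gen GY * free_gen GX)"
    using assms(3) unfolding ageing_relations_def Let_def by blast
  then show ?thesis
  proof cases
    case 1
    then show ?thesis using lmod \<mu>2 assms l by (simp add: S)
  next
    case 2
    then show ?thesis using lmod \<mu>2 assms l by (simp add: S)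
  next
    case 3
    then show ?thesis
      by (simp add: S p5 qS QS mult_ac Qq Q cancel Q_def[symmetric])
  next
    case 4
    then show ?thesis
      by (simp add: S p5 qS QS mult_ac Qq Q cancel Q_def[symmetric])
  next
    case 5
    then show ?thesis
      by (simp add: S p5 qS QS mult_ac Qq Q cancel Q_def[symmetric])
  next
    case 6
    then show ?thesis
      by (cases a1) (simp_all add: S p5 qS QS mult_ac Qq Q cancel Q_def[symmetric])
  next
    case 8
    then show ?thesis
      by (simp add: S p5 qS QS mult_ac Qq Q cancel Q_def[symmetric])
  next
    case 7
    have A: "M3_free_act l1 l q \<mu>1 \<mu>2 (free_gen GE * free_gen GY) (Poly_Mapping.single (a1, a2) 1) =
       Poly_Mapping.single (a1, a2) (- (q^a1 * q^a2 * \<mu>1 * (Q^a1*Q^a1 - 1) / (Q*Q - 1)))"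
      using assms by (cases a1) (auto simp: S mult_ac QqP' cancel' single_uminus[symmetric])
    have B: "M3_free_act l1 l q \<mu>1 \<mu>2 (free_gen GX) (Poly_Mapping.single (a1, a2) 1) =
       Poly_Mapping.single (a1, a2) (\<mu>1 * (Q^a1 * q^a2))"
      by (simp add: S)
    have C: "M3_free_act l1 l q \<mu>1 \<mu>2 (free_const Q * (free_gen GY * free_gen GE)) (Poly_Mapping.single (a1, a2) 1) =
       Poly_Mapping.single (a1, a2) (- (q^a1 * q^a2 * \<mu>1 * (Q*(Q*(Q^a1*Q^a1)) - 1) / (Q*Q - 1)))"
    proof (cases "a1 = l1 - 1")
      case True
      have "Q * (Q * (Q ^ a1 * Q ^ a1)) = 1" by (simp add: top[OF True] Qq Q)
      with True show ?thesis by (simp add: S single_uminus[symmetric])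
    next
      case False
      then show ?thesis by (simp add: S mult_ac Qq QqP' cancel cancel' single_uminus[symmetric])
    qed
    have al: "- (w * m * (s - 1) / D) - (m * b + - (w * m * (Q * (Q * s) - 1) / D)) = 0"
      if "w * s = b" "D \<noteq> 0" "D = Q * Q - 1" for w m s b D
    proof -
      have "- (w * m * (s - 1) / D) - (m * b + - (w * m * (Q * (Q * s) - 1) / D)) =
          (w * m * (Q * (Q * s) - 1) - w * m * (s - 1)) / D - m * b"
        by (simp add: diff_divide_distrib)
      also have "w * m * (Q * (Q * s) - 1) - w * m * (s - 1) = m * (w * s) * D"
        unfolding that(3) by (simp add: algebra_simps)
      also have "m * (w * s) * D / D - m * b = 0"
        using that(1,2) by simp
      finally show ?thesis .
    qed
    have "q^a1 * q^a2 * (Q^a1 * Q^a1) = Q^a1 * q^a2"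
      by (simp add: mult_ac QqP' cancel')
    then show ?thesis
      unfolding 7 p5 M3_free_act_diff M3_free_act_add A B C single_add[symmetric] single_diff[symmetric]
      by (subst al) (use QQ in simp_all)
  qed
qed

lemma M3_act_rel:
  assumes "v \<in> carrier (M3 l1 l q \<mu>1 \<mu>2)" "r \<in> ageing_relations q"
  shows "M3_free_act l1 l q \<mu>1 \<mu>2 r v = 0"
proof -
  have "v = (\<Sum>i\<in>Poly_Mapping.keys v. scale (Poly_Mapping.lookup v i) (Poly_Mapping.single i 1))"
    by (simp add: scale_single sum_singles)
  moreover have "M3_free_act l1 l q \<mu>1 \<mu>2 r (\<Sum>i\<in>A. scale (c i) (Poly_Mapping.single i 1)) = 0"
    if "finite A" "A \<subseteq> {..<l1} \<times> {..<l}" for c A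
    using that
    by induct (auto simp: M3_free_act_zero_right M3_free_act_add_right M3_free_act_scale_right M3_act_basis assms)
  moreover have "Poly_Mapping.keys v \<subseteq> {..<l1} \<times> {..<l}"
    using assms(1) by (simp add: M3_def)
  ultimately show ?thesis by (metis (no_types) finite_keys)
qed

lemma M3_closed_add: "u \<in> carrier (M3 l1 l q \<mu>1 \<mu>2) \<Longrightarrow> v \<in> carrier (M3 l1 l q \<mu>1 \<mu>2) \<Longrightarrow> u + v \<in> carrier (M3 l1 l q \<mu>1 \<mu>2)"
  using keys_add[of u v] by (auto simp: M3_def)

lemma M3_closed_scale: "v \<in> carrier (M3 l1 l q \<mu>1 \<mu>2) \<Longrightarrow> scale c v \<in> carrier (M3 l1 l q \<mu>1 \<mu>2)"
  by (auto simp: M3_def in_keys_iff subset_iff)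

lemma M3_zero: "0 \<in> carrier (M3 l1 l q \<mu>1 \<mu>2)" by (simp add: M3_def)

lemma M3_closed_sum: "(\<And>i. i \<in> A \<Longrightarrow> f i \<in> carrier (M3 l1 l q \<mu>1 \<mu>2)) \<Longrightarrow> sum f A \<in> carrier (M3 l1 l q \<mu>1 \<mu>2)"
  by (induct A rule: infinite_finite_induct) (auto simp: M3_closed_add M3_zero)

lemma M3_basis_act_closed: "i \<in> {..<l1} \<times> {..<l} \<Longrightarrow> M3_basis_act l1 l q \<mu>1 \<mu>2 g i \<in> carrier (M3 l1 l q \<mu>1 \<mu>2)"
  using l by (cases g; cases i) (auto simp: M3_def split: if_splits)

lemma M3_closed_gen: "v \<in> carrier (M3 l1 l q \<mu>1 \<mu>2) \<Longrightarrow> linear_extension (M3_basis_act l1 l q \<mu>1 \<mu>2 g) v \<in> carrier (M3 l1 l q \<mu>1 \<mu>2)"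
  unfolding linear_extension_def
  by (intro M3_closed_sum M3_closed_scale M3_basis_act_closed) (auto simp: M3_def)

lemma M3_closed_word: "v \<in> carrier (M3 l1 l q \<mu>1 \<mu>2) \<Longrightarrow> M3_word_act l1 l q \<mu>1 \<mu>2 w v \<in> carrier (M3 l1 l q \<mu>1 \<mu>2)"
  by (induct w arbitrary: v) (simp_all add: M3_word_act_Nil M3_word_act_Cons M3_closed_gen)

lemma M3_closed_free: "v \<in> carrier (M3 l1 l q \<mu>1 \<mu>2) \<Longrightarrow> M3_free_act l1 l q \<mu>1 \<mu>2 p v \<in> carrier (M3 l1 l q \<mu>1 \<mu>2)"
  unfolding M3_free_act_def linear_extension_def[of "\<lambda>w. M3_word_act l1 l q \<mu>1 \<mu>2 w v"]
  by (intro M3_closed_sum M3_closed_scale M3_closed_word)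

lemma M3_act_ideal:
  assumes "v \<in> carrier (M3 l1 l q \<mu>1 \<mu>2)" "p \<in> ageing_ideal q"
  shows "M3_free_act l1 l q \<mu>1 \<mu>2 p v = 0"
proof -
  define I where "I = {p. \<forall>v\<in>carrier (M3 l1 l q \<mu>1 \<mu>2). M3_free_act l1 l q \<mu>1 \<mu>2 p v = 0}"
  interpret F: ring "free_ring :: (ageing_gen list \<Rightarrow>\<^sub>0 'k) ring" by (rule free_ring_ring)
  have inv: "\<ominus>\<^bsub>free_ring\<^esub> a = - a" for a :: "ageing_gen list \<Rightarrow>\<^sub>0 'k"
    by (rule F.minus_equality) (auto simp: free_ring_def ring_of_type_algebra_def)
  have "ideal I free_ring"
  proof (rule idealI)
    show "subgroup I (add_monoid free_ring)"
    proof (rule group.subgroupI[OF F.add.is_group])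
      fix a assume "a \<in> I"
      then show "inv\<^bsub>add_monoid free_ring\<^esub> a \<in> I"
        using inv[of a] by (simp add: I_def a_inv_def M3_free_act_uminus)
    qed (auto simp: I_def free_ring_def ring_of_type_algebra_def M3_free_act_add intro!: exI[of _ 0] M3_free_act_zero)
  qed (auto simp: I_def free_ring_def ring_of_type_algebra_def M3_free_act_mult M3_free_act_zero_right M3_closed_free
        free_ring_ring[unfolded free_ring_def ring_of_type_algebra_def])
  moreover have "ageing_relations q \<subseteq> I" by (auto simp: I_def M3_act_rel)
  ultimately have "ageing_ideal q \<subseteq> I" unfolding ageing_ideal_def by (rule F.genideal_minimal)
  with assms show ?thesis by (auto simp: I_def)
qed

lemma M3_smult_coset:
  assumes "v \<in> carrier (M3 l1 l q \<mu>1 \<mu>2)"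
  shows "module.smult (M3 l1 l q \<mu>1 \<mu>2) (ageing_ideal q +>\<^bsub>free_ring\<^esub> p) v = M3_free_act l1 l q \<mu>1 \<mu>2 p v"
proof -
  have C: "ageing_ideal q +>\<^bsub>free_ring\<^esub> p = {i + p | i. i \<in> ageing_ideal q}"
    by (auto simp: a_r_coset_def' free_ring_def ring_of_type_algebra_def)
  have "0 \<in> ageing_ideal q"
    using additive_subgroup.zero_closed[OF ideal.axioms(1)[OF ageing_ideal_ideal[of q]]] by (simp add: free_ring_def ring_of_type_algebra_def)
  then show ?thesis unfolding C
    by (auto simp: M3_def M3_free_act_add M3_act_ideal[OF assms] intro!: the_equality)
qed

corollary M3_smult_gen:
  assumes "a1 < l1" "a2 < l"
  shows "module.smult (M3 l1 l q \<mu>1 \<mu>2) (ageing_ideal q +>\<^bsub>free_ring\<^esub> free_gen g) (Poly_Mapping.single (a1, a2) 1) =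
     M3_basis_act l1 l q \<mu>1 \<mu>2 g (a1, a2)"
  using assms by (subst M3_smult_coset) (simp_all add: M3_def M3_free_act_gen linear_extension_single)

corollary M3_smult_const:
  assumes "v \<in> carrier (M3 l1 l q \<mu>1 \<mu>2)"
  shows "module.smult (M3 l1 l q \<mu>1 \<mu>2) (ageing_ideal q +>\<^bsub>free_ring\<^esub> free_const c) v = scale c v"
  by (simp add: M3_smult_coset[OF assms] M3_free_act_const)

end

end

theory Submission
  imports Defs
begin

text \<open>
  Why \<open>M\<^sub>3(\<mu>)\<close> is simple. The generator \<open>E\<close> lowers the first index of \<open>e(a\<^sub>1, a\<^sub>2)\<close>, and the
  coefficient is nonzero as long as \<open>0 < a\<^sub>1 < l\<^sub>1\<close>, because \<open>l\<^sub>1\<close> is the order of \<open>q\<^sup>2\<close>. Hence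
  applying \<open>E\<close> to a nonzero vector until one more step would give zero ends in a nonzero vector of
  the bottom row, the span of the \<open>e(0, a\<^sub>2)\<close> (lemma \<open>submodule_meets_bottom_row\<close>). On that row
  \<open>X\<close> is diagonal with the eigenvalues \<open>\<mu>\<^sub>1 q\<^bsup>a\<^sub>2\<^esup>\<close>, which are pairwise distinct since \<open>q\<close> has order
  \<open>l\<close>; so a nonzero submodule contains some \<open>e(0, a\<^sub>2)\<close> (lemma
  \<open>submodule_contains_bottom_basis_vector\<close>). On the whole of \<open>M\<^sub>3(\<mu>)\<close> the operator \<open>X\<close> has repeated
  eigenvalues, and this is why the descent by \<open>E\<close> has to precede it. From one \<open>e(0, a\<^sub>2)\<close> the
  generator \<open>K\<close> reaches, up to nonzero scalars, the whole bottom row, cyclically, and \<open>Y\<close> reaches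
  from there every basis vector.

  The module axioms come down to the behaviour of the free algebra on representatives, because the
  defining relations act by zero. The dimension is the number of basis vectors.
\<close>

section \<open>Linear extensions and coordinate subspaces\<close>

lemma lookup_linear_extension:
  "Poly_Mapping.lookup (linear_extension f v) j =
     (\<Sum>i\<in>Poly_Mapping.keys v. Poly_Mapping.lookup v i * Poly_Mapping.lookup (f i) j)"
  by (simp add: linear_extension_def lookup_sum)

text \<open>
  If \<open>i\<close> is the only index whose image meets \<open>j\<close>, then the sum of the previous lemma has a single
  term, whether or not \<open>i\<close> lies in the support of \<open>v\<close>.
\<close>

lemma lookup_linear_extension_unique:
  assumes "\<And>k. k \<noteq> i \<Longrightarrow> Poly_Mapping.lookup (f k) j = 0"
  shows "Poly_Mapping.lookup (linear_extension f v) j =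
    Poly_Mapping.lookup v i * Poly_Mapping.lookup (f i) j"
proof -
  have "Poly_Mapping.lookup (linear_extension f v) j =
      (\<Sum>k\<in>Poly_Mapping.keys v.
        if k = i then Poly_Mapping.lookup v i * Poly_Mapping.lookup (f i) j else 0)"
    unfolding lookup_linear_extension by (intro sum.cong) (auto simp: assms)
  then show ?thesis by (simp add: in_keys_iff)
qed

lemma sum_scaled_basis:
  "(\<Sum>i\<in>Poly_Mapping.keys v. scale (Poly_Mapping.lookup v i) (Poly_Mapping.single i 1)) = v"
  by (simp add: scale_single sum_singles)

lemma dim_supported_in:
  assumes "finite A"
  shows "scale.dim {v :: 'i \<Rightarrow>\<^sub>0 'k::field. Poly_Mapping.keys v \<subseteq> A} = card A"
proof -
  define b where "b i = (Poly_Mapping.single i 1 :: 'i \<Rightarrow>\<^sub>0 'k)" for i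
  have inj: "inj_on b A"
    by (rule inj_onI) (metis b_def keys_single one_neq_zero singleton_inject)
  have "scale.independent (b ` A)"
  proof (rule scale.independent_if_scalars_zero)
    fix c u assume z: "(\<Sum>x\<in>b ` A. scale (c x) x) = 0" and "u \<in> b ` A"
    then obtain i where i: "i \<in> A" "u = b i" by auto
    have "0 = Poly_Mapping.lookup (\<Sum>k\<in>A. scale (c (b k)) (b k)) i"
      using z by (simp add: sum.reindex[OF inj])
    also have "\<dots> = (\<Sum>k\<in>A. if k = i then c (b i) else 0)"
      unfolding lookup_sum by (intro sum.cong) (auto simp: b_def lookup_single)
    finally show "c u = 0" using i assms by simp
  qed (use assms in simp)
  moreover have "b ` A \<subseteq> {v. Poly_Mapping.keys v \<subseteq> A}"
    by (auto simp: b_def)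
  moreover have "{v. Poly_Mapping.keys v \<subseteq> A} \<subseteq> scale.span (b ` A)"
  proof
    fix v :: "'i \<Rightarrow>\<^sub>0 'k" assume "v \<in> {v. Poly_Mapping.keys v \<subseteq> A}"
    then have "(\<Sum>i\<in>Poly_Mapping.keys v. scale (Poly_Mapping.lookup v i) (b i)) \<in> scale.span (b ` A)"
      by (intro scale.span_sum scale.span_scale scale.span_base) auto
    then show "v \<in> scale.span (b ` A)" by (simp add: b_def sum_scaled_basis)
  qed
  ultimately show ?thesis
    using scale.dim_unique card_image[OF inj] by blast
qed


section \<open>The quotient algebra\<close>

text \<open>
  Every element of the algebra is the class of an element of the free algebra, and its operations
  are computed on representatives; the module axioms for the quotient thus follow from those for the
  action of the free algebra.
\<close>

lemma ageing_algebra_carrier_iff: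
  "C \<in> carrier (ageing_algebra q) \<longleftrightarrow> (\<exists>p. C = ageing_ideal q +>\<^bsub>free_ring\<^esub> p)"
proof -
  have "carrier free_ring = UNIV" by (simp add: free_ring_def ring_of_type_algebra_def)
  then show ?thesis by (auto simp: ageing_algebra_def FactRing_def A_RCOSETS_def')
qed

lemma ageing_algebra_add:
  "(ageing_ideal q +>\<^bsub>free_ring\<^esub> p) \<oplus>\<^bsub>ageing_algebra q\<^esub> (ageing_ideal q +>\<^bsub>free_ring\<^esub> p') =
    ageing_ideal q +>\<^bsub>free_ring\<^esub> (p + p')"
proof -
  interpret ideal "ageing_ideal q" free_ring by (rule ageing_ideal_ideal)
  show ?thesis
    using a_rcos_sum[of p p']
    by (simp add: ageing_algebra_def FactRing_def) (simp add: free_ring_def ring_of_type_algebra_def)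
qed

lemma ageing_algebra_mult:
  "(ageing_ideal q +>\<^bsub>free_ring\<^esub> p) \<otimes>\<^bsub>ageing_algebra q\<^esub> (ageing_ideal q +>\<^bsub>free_ring\<^esub> p') =
    ageing_ideal q +>\<^bsub>free_ring\<^esub> (p * p')"
proof -
  interpret ideal "ageing_ideal q" free_ring by (rule ageing_ideal_ideal)
  show ?thesis
    using rcoset_mult_add[of p p']
    by (simp add: ageing_algebra_def FactRing_def) (simp add: free_ring_def ring_of_type_algebra_def)
qed

lemma ageing_algebra_one:
  "\<one>\<^bsub>ageing_algebra q\<^esub> = ageing_ideal q +>\<^bsub>free_ring\<^esub> 1"
  by (simp add: ageing_algebra_def FactRing_def) (simp add: free_ring_def ring_of_type_algebra_def)


section \<open>The module axioms\<close>

locale M3_parameters =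
  fixes l l1 :: nat and q \<mu>1 \<mu>2 :: "'k::field"
  assumes l: "l \<ge> 3" and q: "primitive_root_of_unity l q" and \<mu>1: "\<mu>1 \<noteq> 0" and \<mu>2: "\<mu>2 \<noteq> 0"
    and l1: "l1 = mult_order (q^2)"
begin

abbreviation "M \<equiv> M3 l1 l q \<mu>1 \<mu>2"

abbreviation "act g \<equiv> linear_extension (M3_basis_act l1 l q \<mu>1 \<mu>2 g)"

abbreviation (input) e :: "nat \<Rightarrow> nat \<Rightarrow> (nat \<times> nat \<Rightarrow>\<^sub>0 'k)" where
  "e a1 a2 \<equiv> Poly_Mapping.single (a1, a2) 1"

lemmas order_pos = mult_order_pos[OF l q \<mu>1 \<mu>2 l1]
lemmas order_minimal = mult_order_minimal[OF l q \<mu>1 \<mu>2 l1]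
lemmas q_nonzero = root_nonzero[OF l q \<mu>1 \<mu>2 l1]
lemmas smult_coset = M3_smult_coset[OF l q \<mu>1 \<mu>2 l1]
lemmas closed_free = M3_closed_free[OF l q \<mu>1 \<mu>2 l1]
lemmas closed_add = M3_closed_add[OF l q \<mu>1 \<mu>2 l1]

lemma M_zero: "\<zero>\<^bsub>M\<^esub> = 0" and M_add: "u \<oplus>\<^bsub>M\<^esub> v = u + v"
  and M_carrier: "carrier M = {v. Poly_Mapping.keys v \<subseteq> {..<l1} \<times> {..<l}}"
  by (simp_all add: M3_def)

lemma M_abelian_group: "abelian_group M"
proof (rule abelian_groupI)
  fix x assume "x \<in> carrier M"
  then show "\<exists>y\<in>carrier M. y \<oplus>\<^bsub>M\<^esub> x = \<zero>\<^bsub>M\<^esub>"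
    by (intro bexI[of _ "- x"]) (auto simp: M_zero M_add M_carrier)
qed (use closed_add in \<open>auto simp: M_zero M_add add_ac\<close>, simp add: M_carrier)

lemma M_right_module: "right_module (ageing_algebra q) M"
proof -
  interpret A: ring "ageing_algebra q" by (rule ageing_algebra_ring)
  interpret G: abelian_group M by (rule M_abelian_group)
  show ?thesis
  proof
    show "\<one>\<^bsub>ageing_algebra q\<^esub> \<odot>\<^bsub>M\<^esub> x = x" if "x \<in> carrier M" for x
      using that by (simp add: ageing_algebra_one smult_coset M3_free_act_one)
  qed (auto simp: ageing_algebra_carrier_iff ageing_algebra_add ageing_algebra_mult smult_coset
        closed_free M_add closed_add M3_free_act_add M3_free_act_add_right M3_free_act_mult)
qed


section \<open>Coordinates of the action\<close>

lemma inj_on_root_powers: "inj_on (\<lambda>n. q ^ n) {..<l}"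
proof (rule linorder_inj_onI')
  fix i j assume "i \<in> {..<l}" "j \<in> {..<l}" "i < j"
  then have "q ^ (j - i) \<noteq> 1" using root_power_less[OF l q \<mu>1 \<mu>2 l1] by simp
  moreover have "q ^ j = q ^ (j - i) * q ^ i"
    using \<open>i < j\<close> by (simp flip: power_add)
  ultimately show "q ^ i \<noteq> q ^ j" using q_nonzero by simp
qed

lemma lookup_act_X:
  "Poly_Mapping.lookup (act GX v) (a1, a2) =
    Poly_Mapping.lookup v (a1, a2) * (\<mu>1 * q powi (- int a1 + int a2))"
proof (subst lookup_linear_extension_unique[of "(a1, a2)"])
  fix k assume "k \<noteq> (a1, a2)"
  then show "Poly_Mapping.lookup (M3_basis_act l1 l q \<mu>1 \<mu>2 GX k) (a1, a2) = 0"
    by (cases k) (auto simp: lookup_single)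
qed simp

lemma lookup_act_E:
  "Poly_Mapping.lookup (act GE v) (a1, a2) = Poly_Mapping.lookup v (Suc a1, a2) *
    Poly_Mapping.lookup (M3_basis_act l1 l q \<mu>1 \<mu>2 GE (Suc a1, a2)) (a1, a2)"
proof (rule lookup_linear_extension_unique)
  fix k assume "k \<noteq> (Suc a1, a2)"
  then show "Poly_Mapping.lookup (M3_basis_act l1 l q \<mu>1 \<mu>2 GE k) (a1, a2) = 0"
    by (cases k) (auto simp: lookup_single when_def)
qed

text \<open>
  The coefficient is a unit times \<open>(q\<^bsup>-2n\<^esup> - 1) / (q\<^bsup>-2\<^esup> - 1)\<close> with \<open>n = a\<^sub>1 + 1\<close>. Since \<open>0 < n < l\<^sub>1\<close>,
  neither the numerator nor the denominator vanishes; the latter matters because of \<open>x / 0 = 0\<close>.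
\<close>

lemma E_coefficient_nonzero:
  assumes "Suc a1 < l1"
  shows "Poly_Mapping.lookup (M3_basis_act l1 l q \<mu>1 \<mu>2 GE (Suc a1, a2)) (a1, a2) \<noteq> 0"
proof -
  have *: "q powi (- 2 * int n) \<noteq> 1" if "0 < n" "n < l1" for n
  proof -
    have "q powi (- 2 * int n) = inverse ((q^2) ^ n)"
      using q_nonzero by (simp add: power_int_minus power_int_mult)
    then show ?thesis using order_minimal[OF that] by simp
  qed
  have "q powi (- 2 * int (Suc a1)) \<noteq> 1" using * assms by blast
  moreover have "q powi (-2) \<noteq> 1" using *[of 1] assms by simp
  ultimately show ?thesis using q_nonzero \<mu>1 by simp
qed


section \<open>Submodules\<close>

context
  fixes N assumes N: "submodule N (ageing_algebra q) M"
begin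

lemma submodule_subset: "v \<in> N \<Longrightarrow> Poly_Mapping.keys v \<subseteq> {..<l1} \<times> {..<l}"
  using subgroup.subset[OF submodule.axioms(1)[OF N]] by (auto simp: M_carrier)

lemma submodule_zero: "0 \<in> N"
  using subgroup.one_closed[OF submodule.axioms(1)[OF N]] by (simp add: M_zero)

lemma submodule_add: "u \<in> N \<Longrightarrow> v \<in> N \<Longrightarrow> u + v \<in> N"
  using subgroup.m_closed[OF submodule.axioms(1)[OF N]] by (simp add: M_add)

lemma submodule_free_act:
  assumes "v \<in> N" shows "M3_free_act l1 l q \<mu>1 \<mu>2 p v \<in> N"
proof -
  have "v \<in> carrier M" using submodule_subset[OF assms] by (simp add: M_carrier)
  then show ?thesis
    using submodule.smult_closed[OF N _ assms, of "ageing_ideal q +>\<^bsub>free_ring\<^esub> p"]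
    by (auto simp: ageing_algebra_carrier_iff smult_coset)
qed

lemma submodule_act: "v \<in> N \<Longrightarrow> act g v \<in> N"
  using submodule_free_act[of v "free_gen g"] by (simp add: M3_free_act_gen)

lemma submodule_scale: "v \<in> N \<Longrightarrow> scale c v \<in> N"
  using submodule_free_act[of v "free_const c"] by (simp add: M3_free_act_const)

lemma submodule_unscale: "scale c v \<in> N \<Longrightarrow> c \<noteq> 0 \<Longrightarrow> v \<in> N"
  using submodule_scale[of "scale c v" "inverse c"] by simp

lemma submodule_sum: "(\<And>i. i \<in> A \<Longrightarrow> f i \<in> N) \<Longrightarrow> sum f A \<in> N"
  by (induct A rule: infinite_finite_induct) (auto simp: submodule_add submodule_zero)

lemma submodule_basis_act:
  assumes "M3_basis_act l1 l q \<mu>1 \<mu>2 g (a1, a2) = Poly_Mapping.single i c" "c \<noteq> 0" "e a1 a2 \<in> N"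
  shows "Poly_Mapping.single i 1 \<in> N"
  using submodule_act[OF assms(3), of g] assms(1,2) submodule_unscale[of c "Poly_Mapping.single i 1"]
  by (simp add: linear_extension_single scale_single)

text \<open>
  Induction on a bound for the first indices in the support: \<open>E\<close> lowers the bound, and it kills
  only vectors of the bottom row, all its coefficients above that row being nonzero.
\<close>

lemma submodule_meets_bottom_row:
  assumes "v \<in> N" "v \<noteq> 0" "Poly_Mapping.keys v \<subseteq> {..m} \<times> UNIV"
  shows "\<exists>u\<in>N. u \<noteq> 0 \<and> Poly_Mapping.keys u \<subseteq> {0} \<times> UNIV"
  using assms
proof (induct m arbitrary: v)
  case 0
  then show ?case by (auto intro!: bexI[of _ v])
next
  case (Suc m)
  show ?case
  proof (cases "act GE v = 0")
    case False
    have "Poly_Mapping.keys (act GE v) \<subseteq> {..m} \<times> UNIV"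
      using Suc.prems(3) by (auto simp: in_keys_iff lookup_act_E simp del: M3_basis_act.simps)
    then show ?thesis using Suc.hyps[OF submodule_act[OF Suc.prems(1)] False] by blast
  next
    case True
    have "a1 = 0" if "(a1, a2) \<in> Poly_Mapping.keys v" for a1 a2
    proof (cases a1)
      case (Suc b)
      then have "Suc b < l1" using that submodule_subset[OF \<open>v \<in> N\<close>] by auto
      then have "Poly_Mapping.lookup (act GE v) (b, a2) \<noteq> 0"
        using that Suc E_coefficient_nonzero[of b a2]
        by (simp add: lookup_act_E in_keys_iff del: M3_basis_act.simps)
      then show ?thesis using True by simp
    qed
    then show ?thesis using Suc.prems by (intro bexI[of _ v]) auto
  qed
qed

text \<open>
  A vector of minimal support in the bottom row is a multiple of a basis vector: if \<open>a\<^sub>2\<close> and \<open>b\<^sub>2\<close>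
  were distinct indices in its support, then subtracting from its image under \<open>X\<close> its multiple by the
  eigenvalue at \<open>a\<^sub>2\<close> would remove \<open>a\<^sub>2\<close> from the support and keep \<open>b\<^sub>2\<close>.
\<close>

lemma submodule_contains_bottom_basis_vector:
  assumes "N \<noteq> {0}"
  obtains a2 where "a2 < l" "e 0 a2 \<in> N"
proof -
  define P where "P u \<longleftrightarrow> u \<in> N \<and> u \<noteq> 0 \<and> Poly_Mapping.keys u \<subseteq> {0} \<times> UNIV" for u
  obtain v where "v \<in> N" "v \<noteq> 0" using assms submodule_zero by blast
  moreover have "Poly_Mapping.keys v \<subseteq> {..l1} \<times> UNIV"
    using submodule_subset[OF \<open>v \<in> N\<close>] by auto
  ultimately have "\<exists>u. P u" using submodule_meets_bottom_row unfolding P_def by blast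
  then obtain u where "P u"
    and minimal: "\<And>w. P w \<Longrightarrow> card (Poly_Mapping.keys u) \<le> card (Poly_Mapping.keys w)"
    using ex_has_least_nat[of P _ "\<lambda>w. card (Poly_Mapping.keys w)"] by blast
  then have u: "u \<in> N" "u \<noteq> 0" "Poly_Mapping.keys u \<subseteq> {0} \<times> {..<l}"
    using submodule_subset[of u] by (auto simp: P_def)
  then have "Poly_Mapping.keys u \<noteq> {}" by simp
  then obtain a2 where a2: "(0, a2) \<in> Poly_Mapping.keys u" "a2 < l" using u(3) by fast
  define w where "w = act GX u + scale (- (\<mu>1 * q ^ a2)) u"
  have lookup_w: "Poly_Mapping.lookup w (0, b2) =
      Poly_Mapping.lookup u (0, b2) * \<mu>1 * (q ^ b2 - q ^ a2)" for b2
    by (simp add: w_def lookup_add lookup_minus lookup_act_X algebra_simps)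
  have "Poly_Mapping.keys w \<subseteq> Poly_Mapping.keys u"
    by (auto simp: w_def in_keys_iff lookup_add lookup_minus lookup_act_X)
  moreover have "(0, a2) \<notin> Poly_Mapping.keys w" by (simp add: in_keys_iff lookup_w)
  ultimately have keys_w: "Poly_Mapping.keys w \<subset> Poly_Mapping.keys u" using a2 by blast
  then have "card (Poly_Mapping.keys w) < card (Poly_Mapping.keys u)"
    by (intro psubset_card_mono) auto
  then have "\<not> P w" using minimal[of w] by linarith
  moreover have "w \<in> N" unfolding w_def by (intro submodule_add submodule_act submodule_scale u)
  ultimately have "w = 0" using keys_w u by (auto simp: P_def)
  have "Poly_Mapping.keys u = {(0, a2)}"
  proof (rule ccontr)
    assume "Poly_Mapping.keys u \<noteq> {(0, a2)}"
    then obtain b2 where b2: "(0, b2) \<in> Poly_Mapping.keys u" "b2 \<noteq> a2" "b2 < l"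
      using a2 u(3) by fastforce
    then have "q ^ b2 \<noteq> q ^ a2" using inj_on_root_powers a2 by (auto simp: inj_on_def)
    then have "Poly_Mapping.lookup w (0, b2) \<noteq> 0"
      using b2 \<mu>1 by (simp add: lookup_w in_keys_iff)
    then show False using \<open>w = 0\<close> by simp
  qed
  then have "u = scale (Poly_Mapping.lookup u (0, a2)) (e 0 a2)"
    using sum_scaled_basis[of u] by simp
  then have "e 0 a2 \<in> N" using u a2 submodule_unscale by (metis in_keys_iff)
  with a2 that show thesis by blast
qed

text \<open>
  \<open>K\<close> shifts the second index cyclically, so \<open>l - a\<^sub>2 + b\<^sub>2\<close> applications lead from \<open>a\<^sub>2\<close> to \<open>b\<^sub>2\<close>,
  even for \<open>b\<^sub>2 < a\<^sub>2\<close>.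
\<close>

lemma submodule_contains_bottom_row:
  assumes "e 0 a2 \<in> N" "a2 < l" "b2 < l"
  shows "e 0 b2 \<in> N"
proof -
  have "e 0 ((a2 + n) mod l) \<in> N" for n
  proof (induct n)
    case 0
    show ?case using assms by simp
  next
    case (Suc n)
    show ?case
      using submodule_basis_act[OF _ \<mu>2 Suc, of GK] by (simp add: mod_Suc_eq)
  qed
  from this[of "l - a2 + b2"] show ?thesis using assms by simp
qed

text \<open>
  \<open>Y\<close> sends \<open>e(a\<^sub>1, a\<^sub>2)\<close> to a nonzero multiple of \<open>e(a\<^sub>1 + 1, a\<^sub>2)\<close>, except in the top row.
\<close>

lemma submodule_contains_basis:
  assumes "\<And>b2. b2 < l \<Longrightarrow> e 0 b2 \<in> N" "b1 < l1" "b2 < l"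
  shows "e b1 b2 \<in> N"
  using assms(2)
proof (induct b1)
  case 0
  then show ?case using assms by simp
next
  case (Suc b1)
  then have "e b1 b2 \<in> N" "b1 \<noteq> l1 - 1" by auto
  then show ?case
    using submodule_basis_act[of GY b1 b2 "(Suc b1, b2)" "q powi (- int b2)"] Suc.prems q_nonzero
    by simp
qed

lemma submodule_trivial: "N = {0} \<or> N = carrier M"
proof (rule disjCI[THEN disj_commute[THEN iffD1]])
  assume "N \<noteq> {0}"
  then obtain a2 where "a2 < l" "e 0 a2 \<in> N" by (rule submodule_contains_bottom_basis_vector)
  then have basis: "e b1 b2 \<in> N" if "b1 < l1" "b2 < l" for b1 b2
    using that submodule_contains_bottom_row submodule_contains_basis by blast
  have "v \<in> N" if "Poly_Mapping.keys v \<subseteq> {..<l1} \<times> {..<l}" for v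
  proof -
    have "(\<Sum>i\<in>Poly_Mapping.keys v. scale (Poly_Mapping.lookup v i) (Poly_Mapping.single i 1)) \<in> N"
      using that basis by (intro submodule_sum submodule_scale) auto
    then show ?thesis by (simp add: sum_scaled_basis)
  qed
  then show "N = carrier M" using submodule_subset by (auto simp: M_carrier)
qed

end


section \<open>Simplicity and dimension\<close>

lemma M_simple: "simple_right_module (ageing_algebra q) M"
proof -
  have "e 0 0 \<in> carrier M" using order_pos l by (simp add: M_carrier)
  moreover have "e 0 0 \<noteq> 0" by (simp add: poly_mapping_eq_iff fun_eq_iff lookup_single when_def)
  ultimately show ?thesis
    unfolding simple_right_module_def
    using M_right_module submodule_trivial by (auto simp: M_zero)
qed

lemma M_dim: "scale.dim (carrier M) = l1 * l"
  by (simp add: M_carrier dim_supported_in card_cartesian_product)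

end

theorem theorem4p3p1:
  fixes q \<mu>1 \<mu>2 :: "'k::alg_closed_field" and l l1 :: nat
  assumes "primitive_root_of_unity l q" and "l \<ge> 3"
    and "\<mu>1 \<noteq> 0" and "\<mu>2 \<noteq> 0"
    and "l1 = mult_order (q ^ 2)"
  shows "simple_right_module (ageing_algebra q) (M3 l1 l q \<mu>1 \<mu>2) \<and>
         vector_space.dim scale (carrier (M3 l1 l q \<mu>1 \<mu>2)) = l1 * l"
proof -
  interpret M3_parameters l l1 q \<mu>1 \<mu>2 using assms by unfold_locales
  show ?thesis using M_simple M_dim by blast
qed

end
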